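(* Let $G$ be a $d$-regular directed multigraph with a two-way labeling and transition matrix $\mathbf{W}$. Let $H$ be a $c$-regular undirected graph on $d$ vertices with a two-way labeling and $\lambda(H)\le\epsilon$, and let $\widetilde{\mathbf{W}}$ be the transition matrix of the derandomized square $G\text{ⓢ}H$. Then $\widetilde{\mathbf{W}}\stackrel{\circ}{\approx}_{2\epsilon}\mathbf{W}^2$.
   Context: The transition matrix of a digraph with adjacency matrix $\mathbf{A}$ ($\mathbf{A}_{ij}$ = number of edges from $j$ to $i$) and out-degree matrix $\mathbf{D}$ is $\mathbf{A}\mathbf{D}^{-1}$. For a regular multigraph $H$ with transition matrix $\mathbf{B}$, $\lambda(H)=\max_{v\perp\vec1,\,v\neq0}\|\mathbf{B}v\|/\|v\|$. A two-way labeling of a $d$-regular directed multigraph gives each edge $(u,v)$ a label in $[d]$ as an out-edge of $u$ and a label in $[d]$ as an in-edge of $v$, distinct among out-edges and among in-edges at each vertex. The rotation map is $\mathrm{Rot}_G(v,i)=(w,j)$ if the $i$th edge leaving $v$ goes to $w$ and is the $j$th edge entering $w$. The derandomized square $G\text{ⓢ}H$ is the $cd$-regular graph on the vertex set of $G$ with rotation map on $(v_0,(i_0,j_0))$: $(v_1,i_1)=\mathrm{Rot}_G(v_0,i_0)$; $(i_2,j_1)=\mathrm{Rot}_H(i_1,j_0)$; $(v_2,i_3)=\mathrm{Rot}_G(v_1,i_2)$; output $(v_2,(i_3,j_1))$. For $\mathbf{M},\widetilde{\mathbf{M}}\in\mathbb{C}^{m\times m}$, $\widetilde{\mathbf{M}}\stackrel{\circ}{\approx}_\delta\mathbf{M}$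 means: for all $x,y\in\mathbb{C}^m$, $|x^*(\mathbf{M}-\widetilde{\mathbf{M}})y|\le\frac{\delta}{2}(\|x\|^2+\|y\|^2-|x^*\mathbf{M}x+y^*\mathbf{M}y|)$. *)

theory Defs
  imports "HOL-Analysis.Analysis" "Graph_Theory.Digraph"
begin

text \<open>
  Vertex sets and label sets are finite types: a matrix indexed by the vertices of a digraph
  \<open>G\<close> with \<open>verts G = UNIV\<close> is of type \<open>complex ^ 'v ^ 'v\<close>, and the label set \<open>[d]\<close>
  is a type \<open>'d\<close> with \<open>CARD('d) = d\<close>.
\<close>

definition adjacency_matrix :: "('v::finite, 'e) pre_digraph \<Rightarrow> complex ^ 'v ^ 'v" where
  "adjacency_matrix G = (\<chi> i j. of_nat (card {e \<in> arcs G. tail G e = j \<and> head G e = i}))"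

definition outdegree_matrix :: "('v::finite, 'e) pre_digraph \<Rightarrow> complex ^ 'v ^ 'v" where
  "outdegree_matrix G = (\<chi> i j. if i = j then of_nat (out_degree G i) else 0)"

definition transition_matrix :: "('v::finite, 'e) pre_digraph \<Rightarrow> complex ^ 'v ^ 'v" where
  "transition_matrix G = adjacency_matrix G ** matrix_inv (outdegree_matrix G)"

definition regular_digraph :: "nat \<Rightarrow> ('v, 'e) pre_digraph \<Rightarrow> bool" where
  "regular_digraph d G \<longleftrightarrow>
     fin_digraph G \<and> (\<forall>v \<in> verts G. out_degree G v = d \<and> in_degree G v = d)"

text \<open>
  An undirected multigraph is a directed one with as many arcs from \<open>u\<close> to \<open>v\<close> as from
  \<open>v\<close> to \<open>u\<close>. The library predicate \<^const>\<open>symmetric\<close> ignores multiplicities.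
\<close>

definition undirected :: "('v, 'e) pre_digraph \<Rightarrow> bool" where
  "undirected G \<longleftrightarrow> (\<forall>u v.
     card {e \<in> arcs G. tail G e = u \<and> head G e = v} =
     card {e \<in> arcs G. tail G e = v \<and> head G e = u})"

text \<open>\<open>x\<^sup>* y\<close>; the library's \<^const>\<open>inner\<close> on \<open>complex ^ 'n\<close> is only its real part.\<close>

definition hdot :: "complex ^ 'n \<Rightarrow> complex ^ 'n \<Rightarrow> complex" where
  "hdot x y = (\<Sum>i\<in>UNIV. cnj (x $ i) * y $ i)"

text \<open>
  All the quotients are nonnegative, so inserting \<open>0\<close> only matters for a graph with a single
  vertex, where no \<open>v \<noteq> 0\<close> is orthogonal to the all-ones vector and \<open>\<lambda>\<close> is \<open>0\<close>.
\<close>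

definition spectral_lambda :: "('v::finite, 'e) pre_digraph \<Rightarrow> real" where
  "spectral_lambda H =
     Sup (insert 0 {norm (transition_matrix H *v v) / norm v | v.
                     hdot v (\<chi> i. 1) = 0 \<and> v \<noteq> 0})"

text \<open>
  \<open>lo e\<close> is the label of \<open>e\<close> as an out-edge of its tail, \<open>li e\<close> its label as an in-edge of
  its head.
\<close>

definition two_way_labeling ::
  "('v, 'e) pre_digraph \<Rightarrow> ('e \<Rightarrow> 'd) \<Rightarrow> ('e \<Rightarrow> 'd) \<Rightarrow> bool" where
  "two_way_labeling G lo li \<longleftrightarrow>
     (\<forall>v \<in> verts G. inj_on lo (out_arcs G v) \<and> inj_on li (in_arcs G v))"

definition rotation_map ::
  "('v, 'e) pre_digraph \<Rightarrow> ('e \<Rightarrow> 'd) \<Rightarrow> ('e \<Rightarrow> 'd) \<Rightarrow> 'v \<times> 'd \<Rightarrow> 'v \<times> 'd" where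
  "rotation_map G lo li = (\<lambda>(v, i).
     let e = (THE e. e \<in> out_arcs G v \<and> lo e = i) in (head G e, li e))"

text \<open>
  The digraph on \<open>V\<close> with rotation map \<open>R\<close>: its arcs are the pairs of a vertex and an
  out-label, and it is labeled by \<open>snd\<close> and \<open>snd \<circ> R\<close>.
\<close>

definition digraph_of_rotation_map ::
  "'v set \<Rightarrow> ('v \<times> 'l \<Rightarrow> 'v \<times> 'l) \<Rightarrow> ('v, 'v \<times> 'l) pre_digraph" where
  "digraph_of_rotation_map V R =
     \<lparr>verts = V, arcs = V \<times> UNIV, tail = fst, head = fst \<circ> R\<rparr>"

definition derandomized_square_map ::
  "('v \<times> 'd \<Rightarrow> 'v \<times> 'd) \<Rightarrow> ('d \<times> 'c \<Rightarrow> 'd \<times> 'c) \<Rightarrow>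
   'v \<times> ('d \<times> 'c) \<Rightarrow> 'v \<times> ('d \<times> 'c)" where
  "derandomized_square_map RG RH = (\<lambda>(v0, (i0, j0)).
     let (v1, i1) = RG (v0, i0);
         (i2, j1) = RH (i1, j0);
         (v2, i3) = RG (v1, i2)
     in (v2, (i3, j1)))"

definition derandomized_square ::
  "('v, 'e) pre_digraph \<Rightarrow> ('e \<Rightarrow> 'd) \<Rightarrow> ('e \<Rightarrow> 'd) \<Rightarrow>
   ('d, 'f) pre_digraph \<Rightarrow> ('f \<Rightarrow> 'c) \<Rightarrow> ('f \<Rightarrow> 'c) \<Rightarrow>
   ('v, 'v \<times> ('d \<times> 'c)) pre_digraph" where
  "derandomized_square G lo li H lo' li' =
     digraph_of_rotation_map (verts G)
       (derandomized_square_map (rotation_map G lo li) (rotation_map H lo' li'))"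

text \<open>\<open>circle_approx \<delta> M' M\<close>: the matrix \<open>M'\<close> is a \<open>\<delta>\<close>-approximation of \<open>M\<close>.\<close>

definition circle_approx :: "real \<Rightarrow> complex ^ 'n ^ 'n \<Rightarrow> complex ^ 'n ^ 'n \<Rightarrow> bool" where
  "circle_approx \<delta> M' M \<longleftrightarrow> (\<forall>x y.
     cmod (hdot x ((M - M') *v y)) \<le>
       \<delta> / 2 * ((norm x)\<^sup>2 + (norm y)\<^sup>2 - cmod (hdot x (M *v x) + hdot y (M *v y))))"

lemma rotation_map_digraph_of_rotation_map:
  assumes "v \<in> V"
  shows "rotation_map (digraph_of_rotation_map V R) snd (snd \<circ> R) (v, i) = R (v, i)"
proof -
  have "(THE e. e \<in> out_arcs (digraph_of_rotation_map V R) v \<and> snd e = i) = (v, i)"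
    using assms by (auto simp: out_arcs_def digraph_of_rotation_map_def)
  then show ?thesis
    by (simp add: rotation_map_def digraph_of_rotation_map_def)
qed

lemma rotation_map_eqI:
  assumes "two_way_labeling G lo li" "e \<in> out_arcs G v" "lo e = i" "v \<in> verts G"
  shows "rotation_map G lo li (v, i) = (head G e, li e)"
proof -
  have "(THE e. e \<in> out_arcs G v \<and> lo e = i) = e"
    using assms by (auto simp: two_way_labeling_def inj_on_def)
  then show ?thesis
    by (simp add: rotation_map_def)
qed

lemma bij_rotation_map:
  fixes G :: "('v::finite, 'e) pre_digraph" and lo li :: "'e \<Rightarrow> 'd::finite"
  assumes V: "verts G = UNIV" and reg: "regular_digraph CARD('d) G"
    and lab: "two_way_labeling G lo li"
  shows "bij (rotation_map G lo li)"
proof -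
  have ex: "\<exists>e \<in> out_arcs G v. lo e = i" for v i
  proof -
    have "inj_on lo (out_arcs G v)"
      using lab V by (simp add: two_way_labeling_def)
    then have "card (lo ` out_arcs G v) = CARD('d)"
      using reg V by (simp add: card_image regular_digraph_def out_degree_def)
    then have "lo ` out_arcs G v = UNIV"
      by (simp add: card_eq_UNIV_imp_eq_UNIV)
    then show ?thesis
      by (metis UNIV_I imageE)
  qed
  have "inj (rotation_map G lo li)"
  proof (rule injI, clarify)
    fix v i v' i'
    assume eq: "rotation_map G lo li (v, i) = rotation_map G lo li (v', i')"
    obtain e where e: "e \<in> out_arcs G v" "lo e = i" using ex by blast
    obtain e' where e': "e' \<in> out_arcs G v'" "lo e' = i'" using ex by blast
    have "head G e = head G e'" "li e = li e'"
      using eq rotation_map_eqI[OF lab e] rotation_map_eqI[OF lab e'] V by auto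
    then have "e = e'"
      using lab V e(1) e'(1)
      by (auto simp: two_way_labeling_def inj_on_def in_arcs_def out_arcs_def)
    then show "v = v' \<and> i = i'"
      using e e' by (auto simp: out_arcs_def)
  qed
  then show ?thesis
    by (simp add: finite_UNIV_inj_surj bij_def)
qed

lemma bij_derandomized_square_map:
  fixes RG :: "'v::finite \<times> 'd::finite \<Rightarrow> 'v \<times> 'd" and RH :: "'d \<times> 'c::finite \<Rightarrow> 'd \<times> 'c"
  assumes "bij RG" "bij RH"
  shows "bij (derandomized_square_map RG RH)"
proof -
  have RG: "RG p = RG q \<Longrightarrow> p = q" and RH: "RH r = RH s \<Longrightarrow> r = s" for p q r s
    using assms by (metis bij_def injD)+
  have "inj (derandomized_square_map RG RH)"
  proof (rule injI, simp only: split_paired_all)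
    fix v i j v' i' j'
    assume eq: "derandomized_square_map RG RH (v, i, j) = derandomized_square_map RG RH (v', i', j')"
    obtain v1 i1 where g: "RG (v, i) = (v1, i1)" by fastforce
    obtain v1' i1' where g': "RG (v', i') = (v1', i1')" by fastforce
    obtain i2 j1 where h: "RH (i1, j) = (i2, j1)" by fastforce
    obtain i2' j1' where h': "RH (i1', j') = (i2', j1')" by fastforce
    have "RG (v1, i2) = RG (v1', i2')" and j1: "j1 = j1'"
      using eq by (auto simp: derandomized_square_map_def g g' h h' split: prod.splits)
    then have "v1 = v1'" "i2 = i2'" using RG by blast+
    moreover have "i1 = i1'" "j = j'" using RH[of "(i1, j)" "(i1', j')"] h h' j1 calculation by auto
    ultimately show "(v, i, j) = (v', i', j')" using RG[of "(v, i)" "(v', i')"] g g' by auto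
  qed
  then show ?thesis
    by (simp add: finite_UNIV_inj_surj bij_def)
qed

lemma digraph_of_rotation_map_regular:
  fixes R :: "'v::finite \<times> 'l::finite \<Rightarrow> 'v \<times> 'l"
  assumes "bij R"
  shows "regular_digraph CARD('l) (digraph_of_rotation_map UNIV R)"
    and "two_way_labeling (digraph_of_rotation_map UNIV R) snd (snd \<circ> R)"
proof -
  let ?G = "digraph_of_rotation_map UNIV R"
  have out: "out_arcs ?G v = {v} \<times> UNIV" for v
    by (auto simp: out_arcs_def digraph_of_rotation_map_def)
  have in_eq: "in_arcs ?G v = R -` ({v} \<times> UNIV)" for v
    by (auto simp: in_arcs_def digraph_of_rotation_map_def mem_Times_iff)
  have "card (in_arcs ?G v) = CARD('l)" for v
    using assms by (simp add: in_eq card_vimage_inj bij_def card_cartesian_product)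
  moreover have "fin_digraph ?G"
    by unfold_locales (auto simp: digraph_of_rotation_map_def)
  ultimately show "regular_digraph CARD('l) ?G"
    by (simp add: regular_digraph_def out_degree_def in_degree_def out card_cartesian_product)
  show "two_way_labeling ?G snd (snd \<circ> R)"
    unfolding two_way_labeling_def out in_eq
  proof (intro ballI conjI inj_onI)
    fix v p q
    assume "p \<in> R -` ({v} \<times> UNIV)" "q \<in> R -` ({v} \<times> UNIV)" "(snd \<circ> R) p = (snd \<circ> R) q"
    then have "R p = R q" by (auto simp: prod_eq_iff mem_Times_iff)
    then show "p = q" using assms by (metis bij_def injD)
  qed auto
qed

lemma derandomized_square_regular:
  fixes G :: "('v::finite, 'e) pre_digraph" and lo li :: "'e \<Rightarrow> 'd::finite"
    and H :: "('d, 'f) pre_digraph" and lo' li' :: "'f \<Rightarrow> 'c::finite"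
  assumes "verts G = UNIV" "regular_digraph CARD('d) G" "two_way_labeling G lo li"
    and "verts H = UNIV" "regular_digraph CARD('c) H" "two_way_labeling H lo' li'"
  shows "regular_digraph (CARD('c) * CARD('d)) (derandomized_square G lo li H lo' li')"
  using digraph_of_rotation_map_regular(1)[OF bij_derandomized_square_map[OF
      bij_rotation_map[OF assms(1-3)] bij_rotation_map[OF assms(4-6)]]] assms(1)
  by (simp add: derandomized_square_def mult.commute)

end

theory Submission
  imports Defs
begin

text \<open>
  Fix a vertex \<open>v\<close> of \<open>G\<close>. Let \<open>a\<close> list the values of \<open>x\<close> at the heads of the arcs leaving \<open>v\<close>,
  and \<open>b\<close> the values of \<open>y\<close> at the tails of the arcs entering \<open>v\<close>. Splitting walks of length two at
  their middle vertex, \<open>x\<^sup>* W\<^sup>2 y\<close> is the sum over \<open>v\<close> of \<open>(1/d) a\<^sup>* J b\<close>, with \<open>J\<close> the averaging matrix,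
  whereas \<open>x\<^sup>* W' y\<close> for the derandomized square \<open>W'\<close> is the sum of \<open>(1/d) a\<^sup>* B b\<close>, with \<open>B\<close> the
  transition matrix of \<open>H\<close>. Since \<open>B\<close> preserves constants and their orthogonal complement, each
  difference is at most \<open>\<epsilon>/d\<close> times the product of the norms of the centred vectors, and AM-GM gives
  \<open>|x\<^sup>* (W\<^sup>2 - W') y| \<le> \<epsilon>/2 (|x|\<^sup>2 + |y|\<^sup>2 - |W\<^sup>* x|\<^sup>2 - |W y|\<^sup>2)\<close>. Finally
  \<open>2 |x\<^sup>* W\<^sup>2 x| \<le> |W\<^sup>* x|\<^sup>2 + |x|\<^sup>2\<close> and \<open>2 |y\<^sup>* W\<^sup>2 y| \<le> |y|\<^sup>2 + |W y|\<^sup>2\<close> because \<open>W\<close> is a contraction.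
\<close>

section \<open>Hermitian form, means and centring\<close>

lemma norm_vec_power2: "(norm (x :: complex ^ 'n))\<^sup>2 = (\<Sum>i\<in>UNIV. (cmod (x $ i))\<^sup>2)"
  by (simp add: norm_vec_def L2_set_def sum_nonneg)

lemma cmod_hdot_le: "cmod (hdot x y) \<le> norm x * norm y"
proof -
  have "cmod (hdot x y) \<le> (\<Sum>i\<in>UNIV. cmod (cnj (x $ i) * y $ i))"
    unfolding hdot_def by (rule norm_sum)
  also have "\<dots> = (\<Sum>i\<in>UNIV. \<bar>cmod (x $ i)\<bar> * \<bar>cmod (y $ i)\<bar>)"
    by (simp add: norm_mult)
  also have "\<dots> \<le> norm x * norm y"
    unfolding norm_vec_def by (rule L2_set_mult_ineq)
  finally show ?thesis .
qed

lemma hdot_diff_left: "hdot (x - y) z = hdot x z - hdot y z"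
  by (simp add: hdot_def algebra_simps sum_subtractf)

lemma hdot_diff_right: "hdot x (y - z) = hdot x y - hdot x z"
  by (simp add: hdot_def algebra_simps sum_subtractf)

definition vec_mean :: "complex ^ 'n \<Rightarrow> complex" where
  "vec_mean x = (\<Sum>i\<in>UNIV. x $ i) / of_nat CARD('n)"

lemma hdot_vec_left: "hdot (vec c) y = of_nat CARD('n) * (cnj c * vec_mean y)"
  for y :: "complex ^ 'n"
  by (simp add: hdot_def vec_mean_def flip: sum_distrib_left)

lemma hdot_vec_right: "hdot x (vec c) = of_nat CARD('n) * (cnj (vec_mean x) * c)"
  for x :: "complex ^ 'n"
  by (simp add: hdot_def vec_mean_def flip: sum_distrib_right)

lemma vec_mean_vec: "vec_mean (vec c) = c"
  by (simp add: vec_mean_def)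

lemma sum_centred: "(\<Sum>i\<in>UNIV. (x - vec (vec_mean x)) $ i) = 0" for x :: "complex ^ 'n"
  by (simp add: sum_subtractf vec_mean_def)

text \<open>Pythagoras: the constant vector of the mean and the centred rest are orthogonal.\<close>

lemma norm_centred_power2:
  "(norm (x - vec (vec_mean x)))\<^sup>2 = (norm x)\<^sup>2 - CARD('n) * (cmod (vec_mean x))\<^sup>2"
  for x :: "complex ^ 'n"
proof -
  have hd: "complex_of_real ((norm z)\<^sup>2) = hdot z z" for z :: "complex ^ 'n"
    by (simp add: norm_vec_power2 hdot_def mult.commute complex_norm_square del: of_real_power)
  let ?m = "vec_mean x"
  have "complex_of_real ((norm (x - vec ?m))\<^sup>2) = hdot x (x - vec ?m) - hdot (vec ?m) (x - vec ?m)"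
    by (simp only: hd hdot_diff_left)
  also have "\<dots> = hdot x x - hdot x (vec ?m)"
    by (simp add: hdot_vec_left hdot_diff_right vec_mean_vec)
  also have "\<dots> = hdot x x - of_nat CARD('n) * (?m * cnj ?m)"
    by (simp add: hdot_vec_right)
  also have "\<dots> = complex_of_real ((norm x)\<^sup>2 - CARD('n) * (cmod ?m)\<^sup>2)"
    by (simp add: hd[symmetric] complex_norm_square[symmetric])
  finally show ?thesis
    using of_real_eq_iff by blast
qed

lemma card_vec_mean_power2_le: "CARD('n) * (cmod (vec_mean x))\<^sup>2 \<le> (norm x)\<^sup>2"
  for x :: "complex ^ 'n"
  using norm_centred_power2[of x] zero_le_power2[of "norm (x - vec (vec_mean x))"] by linarith

section \<open>Transition matrices of labeled regular digraphs\<close>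

lemma sum_mult_of_bool_point:
  fixes f :: "'a::finite \<Rightarrow> 'b::semiring_1"
  shows "(\<Sum>i\<in>UNIV. f i * of_bool (i = k)) = f k"
proof -
  have "(\<Sum>i\<in>UNIV. f i * of_bool (i = k)) = (\<Sum>i\<in>UNIV. if i = k then f i else 0)"
    by (intro sum.cong) auto
  then show ?thesis by simp
qed

lemma mat_mult_mat: "mat a ** mat b = (mat (a * b) :: complex ^ 'n ^ 'n)"
proof -
  have "(mat a ** mat b :: complex ^ 'n ^ 'n) $ i $ j = mat (a * b) $ i $ j" for i j
  proof -
    have "(mat a ** mat b :: complex ^ 'n ^ 'n) $ i $ j =
        (\<Sum>k\<in>UNIV. (a * (mat b :: complex ^ 'n ^ 'n) $ k $ j) * of_bool (k = i))"
      unfolding matrix_matrix_mult_def vec_lambda_beta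
      by (rule sum.cong) (auto simp: mat_def)
    then show ?thesis
      unfolding sum_mult_of_bool_point by (simp add: mat_def)
  qed
  then show ?thesis
    by (simp add: vec_eq_iff)
qed

lemma matrix_inv_mat:
  assumes "c \<noteq> 0"
  shows "matrix_inv (mat c :: complex ^ 'n ^ 'n) = mat (inverse c)"
proof -
  have eq: "mat c ** mat (inverse c) = (mat 1 :: complex ^ 'n ^ 'n)"
    "mat (inverse c) ** mat c = (mat 1 :: complex ^ 'n ^ 'n)"
    using assms by (simp_all add: mat_mult_mat)
  \<comment> \<open>\<open>matrix_inv\<close> picks some two-sided inverse, so a witness has to come
    first; uniqueness of inverses then identifies the choice.\<close>
  then have "matrix_inv (mat c) ** mat c = (mat 1 :: complex ^ 'n ^ 'n)"
    unfolding matrix_inv_def by (metis (mono_tags, lifting) someI_ex)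
  then show ?thesis
    by (metis eq(1) matrix_mul_assoc matrix_mul_lid matrix_mul_rid)
qed

lemma transition_matrix_regular:
  fixes G :: "('v::finite, 'e) pre_digraph"
  assumes "verts G = UNIV" "regular_digraph d G" "d > 0"
  shows "transition_matrix G $ i $ j =
    of_nat (card {e \<in> arcs G. tail G e = j \<and> head G e = i}) / of_nat d"
proof -
  have "outdegree_matrix G = mat (of_nat d)"
    using assms by (simp add: outdegree_matrix_def mat_def regular_digraph_def vec_eq_iff)
  then have "transition_matrix G = adjacency_matrix G ** mat (inverse (of_nat d))"
    using assms(3) by (simp add: transition_matrix_def matrix_inv_mat)
  then show ?thesis
    by (simp add: adjacency_matrix_def matrix_matrix_mult_def mat_def if_distrib if_distribR
        divide_inverse cong: if_cong)
qed

text \<open>Distinct labels on \<open>CARD('d)\<close> out-arcs exhaust the label set, so an arc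
  amounts to its tail together with its out-label.\<close>

lemma bij_betw_tail_label:
  fixes G :: "('v::finite, 'e) pre_digraph" and lo li :: "'e \<Rightarrow> 'd::finite"
  assumes V: "verts G = UNIV" and reg: "regular_digraph CARD('d) G"
    and lab: "two_way_labeling G lo li"
  shows "bij_betw (\<lambda>e. (tail G e, lo e)) (arcs G) UNIV"
proof (rule bij_betw_imageI)
  have inj: "inj_on lo (out_arcs G v)" for v
    using lab V by (simp add: two_way_labeling_def)
  then show "inj_on (\<lambda>e. (tail G e, lo e)) (arcs G)"
    by (fastforce simp: inj_on_def)
  have "lo ` out_arcs G v = UNIV" for v
    using inj[of v] reg V
    by (intro card_eq_UNIV_imp_eq_UNIV) (simp_all add: card_image regular_digraph_def out_degree_def)
  then have "\<exists>e\<in>arcs G. tail G e = v \<and> lo e = i" for v i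
    by (metis UNIV_I imageE in_out_arcs_conv)
  then have "(v, i) \<in> (\<lambda>e. (tail G e, lo e)) ` arcs G" for v i
    by (metis (mono_tags, lifting) image_eqI)
  then show "(\<lambda>e. (tail G e, lo e)) ` arcs G = UNIV"
    by auto
qed

text \<open>Each arc contributes the conjugate of \<open>x\<close> at its head times
  \<open>y\<close> at its tail. Indexing arcs by tail and out-label puts \<open>G\<close>,
  \<open>H\<close> and the derandomized square into one common form.\<close>

lemma hdot_transition_matrix:
  fixes G :: "('v::finite, 'e) pre_digraph" and lo li :: "'e \<Rightarrow> 'd::finite"
  assumes V: "verts G = UNIV" and reg: "regular_digraph CARD('d) G"
    and lab: "two_way_labeling G lo li"
  shows "hdot x (transition_matrix G *v y) =
    (\<Sum>p\<in>UNIV. cnj (x $ fst (rotation_map G lo li p)) * y $ fst p) / of_nat CARD('d)"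
proof -
  have fin: "finite (arcs G)"
    using reg by (simp add: regular_digraph_def fin_digraph.finite_arcs)
  have T: "transition_matrix G $ i $ j =
    (\<Sum>e\<in>arcs G. of_bool (j = tail G e) * of_bool (i = head G e)) / of_nat CARD('d)" for i j
  proof -
    have "(\<Sum>e\<in>arcs G. of_bool (j = tail G e) * of_bool (i = head G e) :: complex) =
        (\<Sum>e\<in>{e \<in> arcs G. tail G e = j \<and> head G e = i}. 1)"
      using fin by (intro sum.mono_neutral_cong_right) auto
    then show ?thesis
      using transition_matrix_regular[OF V reg] by simp
  qed
  let ?t = "\<lambda>i j e. cnj (x $ i) * y $ j * (of_bool (j = tail G e) * of_bool (i = head G e))"
  have t: "(\<Sum>i\<in>UNIV. \<Sum>j\<in>UNIV. ?t i j e) = cnj (x $ head G e) * y $ tail G e" for e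
  proof -
    have "(\<Sum>i\<in>UNIV. \<Sum>j\<in>UNIV. ?t i j e) =
        (\<Sum>i\<in>UNIV. cnj (x $ i) * of_bool (i = head G e)) *
        (\<Sum>j\<in>UNIV. y $ j * of_bool (j = tail G e))"
      unfolding sum_product by (simp only: mult_ac)
    then show ?thesis
      by (simp only: sum_mult_of_bool_point)
  qed
  have "hdot x (transition_matrix G *v y) =
      (\<Sum>i\<in>UNIV. \<Sum>j\<in>UNIV. cnj (x $ i) * y $ j * transition_matrix G $ i $ j)"
    by (simp add: hdot_def matrix_vector_mult_def sum_distrib_left mult_ac)
  also have "\<dots> = (\<Sum>i\<in>UNIV. \<Sum>j\<in>UNIV. \<Sum>e\<in>arcs G. ?t i j e) / of_nat CARD('d)"
    by (simp only: T times_divide_eq_right sum_distrib_left sum_divide_distrib)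
  also have "(\<Sum>i\<in>UNIV. \<Sum>j\<in>UNIV. \<Sum>e\<in>arcs G. ?t i j e) =
      (\<Sum>e\<in>arcs G. \<Sum>i\<in>UNIV. \<Sum>j\<in>UNIV. ?t i j e)"
    by (simp only: sum.swap[of _ "arcs G"])
  also have "\<dots> = (\<Sum>e\<in>arcs G. cnj (x $ head G e) * y $ tail G e)"
    by (simp only: t)
  also have "\<dots> = (\<Sum>e\<in>arcs G.
      cnj (x $ fst (rotation_map G lo li (tail G e, lo e))) * y $ fst (tail G e, lo e))"
    using rotation_map_eqI[OF lab] V by (intro sum.cong) auto
  also have "\<dots> = (\<Sum>p\<in>UNIV. cnj (x $ fst (rotation_map G lo li p)) * y $ fst p)"
    by (rule sum.reindex_bij_betw[OF bij_betw_tail_label[OF assms]])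
  finally show ?thesis .
qed

lemma sum_UNIV_Times:
  "(\<Sum>p\<in>(UNIV :: ('a::finite \<times> 'b::finite) set). f p) = (\<Sum>a\<in>UNIV. \<Sum>b\<in>UNIV. f (a, b))"
  by (simp add: sum.cartesian_product flip: UNIV_Times_UNIV)

section \<open>The spectral bound at a single vertex\<close>

lemma bdd_above_spectral_quotients:
  "bdd_above (insert 0 {norm (transition_matrix H *v v) / norm v | v.
     hdot v (\<chi> i. 1) = 0 \<and> v \<noteq> 0})" (is "bdd_above (insert 0 ?S)")
proof -
  obtain K where K: "norm (transition_matrix H *v v) \<le> norm v * K" for v
    using bounded_linear.bounded[OF matrix_vector_mul_bounded_linear[of "transition_matrix H"]]
    by blast
  have "bdd_above ?S"
  proof (rule bdd_aboveI)
    fix r assume "r \<in> ?S"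
    then obtain v where "v \<noteq> 0" "r = norm (transition_matrix H *v v) / norm v"
      by blast
    then show "r \<le> K"
      using K[of v] by (simp add: divide_le_eq mult.commute)
  qed
  then show ?thesis by simp
qed

lemma spectral_lambda_nonneg: "0 \<le> spectral_lambda H"
  unfolding spectral_lambda_def by (rule cSup_upper[OF insertI1 bdd_above_spectral_quotients])

lemma norm_transition_matrix_le_spectral_lambda:
  assumes "(\<Sum>i\<in>UNIV. u $ i) = 0"
  shows "norm (transition_matrix H *v u) \<le> spectral_lambda H * norm u"
proof (cases "u = 0")
  case False
  have "hdot u (\<chi> i. 1) = 0"
    using assms by (simp add: hdot_def flip: cnj_sum)
  then have "norm (transition_matrix H *v u) / norm u \<le> spectral_lambda H"
    unfolding spectral_lambda_def using False
    by (intro cSup_upper[OF _ bdd_above_spectral_quotients]) blast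
  then show ?thesis
    using False by (simp add: divide_le_eq)
qed auto

text \<open>The first term under \<open>cmod\<close> is the form of the averaging matrix. It agrees
  with the form of \<open>transition_matrix H\<close> as soon as one argument is constant, so only
  the centred parts contribute.\<close>

lemma transition_matrix_deviation_le:
  fixes H :: "('d::finite, 'f) pre_digraph" and lo li :: "'f \<Rightarrow> 'c::finite"
    and a b :: "complex ^ 'd"
  assumes H: "verts H = UNIV" "regular_digraph CARD('c) H" "two_way_labeling H lo li"
    and eps: "spectral_lambda H \<le> \<epsilon>"
  shows "cmod (of_nat CARD('d) * (cnj (vec_mean a) * vec_mean b) - hdot a (transition_matrix H *v b))
    \<le> \<epsilon> / 2 * ((norm a)\<^sup>2 + (norm b)\<^sup>2
        - CARD('d) * ((cmod (vec_mean a))\<^sup>2 + (cmod (vec_mean b))\<^sup>2))"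
proof -
  let ?B = "transition_matrix H"
  let ?a = "a - vec (vec_mean a)" and ?b = "b - vec (vec_mean b)"
  note B = hdot_transition_matrix[OF H]
  have bij: "bij (rotation_map H lo li)"
    by (rule bij_rotation_map[OF H])
  \<comment> \<open>Bijectivity of the rotation map makes every vertex the head of
    \<open>CARD('c)\<close> arcs, so \<open>?B\<close> fixes constants.\<close>
  have const_right: "hdot z (?B *v vec m) = hdot z (vec m)" for z m
  proof -
    have "(\<Sum>p\<in>UNIV. cnj (z $ fst (rotation_map H lo li p)) * m) =
        (\<Sum>p\<in>(UNIV :: ('d \<times> 'c) set). cnj (z $ fst p) * m)"
      by (rule sum.reindex_bij_betw[OF bij])
    then show ?thesis
      unfolding B unfolding hdot_def by (simp add: sum_UNIV_Times flip: sum_distrib_left)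
  qed
  \<comment> \<open>Dually, every vertex is the tail of \<open>CARD('c)\<close> arcs, so the columns
    of \<open>?B\<close> sum to one.\<close>
  have const_left: "hdot (vec m) (?B *v z) = hdot (vec m) z" for z m
    unfolding B unfolding hdot_def by (simp add: sum_UNIV_Times flip: sum_distrib_left)
  have "hdot ?a (?B *v ?b) = hdot a (?B *v b) - of_nat CARD('d) * (cnj (vec_mean a) * vec_mean b)"
    unfolding matrix_vector_mult_diff_distrib hdot_diff_left hdot_diff_right const_left const_right
    by (simp add: hdot_vec_left hdot_vec_right vec_mean_vec)
  then have "cmod (of_nat CARD('d) * (cnj (vec_mean a) * vec_mean b) - hdot a (?B *v b)) =
      cmod (hdot ?a (?B *v ?b))"
    by (simp add: norm_minus_commute)
  also have "\<dots> \<le> norm ?a * norm (?B *v ?b)"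
    by (rule cmod_hdot_le)
  also have "\<dots> \<le> norm ?a * (spectral_lambda H * norm ?b)"
    by (intro mult_left_mono norm_transition_matrix_le_spectral_lambda sum_centred norm_ge_zero)
  also have "\<dots> \<le> norm ?a * (\<epsilon> * norm ?b)"
    by (intro mult_left_mono mult_right_mono eps norm_ge_zero)
  also have "\<dots> = \<epsilon> / 2 * (2 * norm ?a * norm ?b)"
    by simp
  \<comment> \<open>AM-GM; \<epsilon> is nonnegative because it bounds
    \<open>spectral_lambda H\<close>.\<close>
  also have "\<dots> \<le> \<epsilon> / 2 * ((norm ?a)\<^sup>2 + (norm ?b)\<^sup>2)"
    using spectral_lambda_nonneg[of H] eps by (intro mult_left_mono sum_squares_bound) auto
  also have "\<dots> = \<epsilon> / 2 * ((norm a)\<^sup>2 + (norm b)\<^sup>2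
        - CARD('d) * ((cmod (vec_mean a))\<^sup>2 + (cmod (vec_mean b))\<^sup>2))"
    by (simp add: norm_centred_power2 algebra_simps)
  finally show ?thesis .
qed

section \<open>Values at neighbours, the adjoint and contraction\<close>

definition out_values :: "('v \<times> 'd \<Rightarrow> 'v \<times> 'd) \<Rightarrow> complex ^ 'v \<Rightarrow> 'v \<Rightarrow> complex ^ 'd" where
  "out_values R x v = (\<chi> i. x $ fst (R (v, i)))"

text \<open>A rotation map takes tail and out-label to head and in-label, so its inverse at
  \<open>(v, i)\<close> yields the tail of the arc entering \<open>v\<close> with in-label
  \<open>i\<close>.\<close>

definition in_values :: "('v \<times> 'd \<Rightarrow> 'v \<times> 'd) \<Rightarrow> complex ^ 'v \<Rightarrow> 'v \<Rightarrow> complex ^ 'd" where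
  "in_values R y v = (\<chi> i. y $ fst (inv R (v, i)))"

text \<open>For the rotation map of a labeled regular digraph with transition matrix
  \<open>W\<close> this is \<open>W\<^sup>* x\<close>.\<close>

definition mean_out ::
  "('v \<times> 'd::finite \<Rightarrow> 'v \<times> 'd) \<Rightarrow> complex ^ 'v \<Rightarrow> complex ^ 'v" where
  "mean_out R x = (\<chi> v. vec_mean (out_values R x v))"

text \<open>Double counting: since \<open>R\<close> is bijective, every vertex occurs as a head
  exactly \<open>CARD('d)\<close> times.\<close>

lemma sum_norm_out_values:
  fixes R :: "'v::finite \<times> 'd::finite \<Rightarrow> 'v \<times> 'd"
  assumes "bij R"
  shows "(\<Sum>v\<in>UNIV. (norm (out_values R x v))\<^sup>2) = CARD('d) * (norm x)\<^sup>2"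
proof -
  have "(\<Sum>v\<in>UNIV. (norm (out_values R x v))\<^sup>2) = (\<Sum>p\<in>UNIV. (cmod (x $ fst (R p)))\<^sup>2)"
    by (simp add: norm_vec_power2 out_values_def sum_UNIV_Times)
  also have "\<dots> = (\<Sum>p\<in>(UNIV :: ('v \<times> 'd) set). (cmod (x $ fst p))\<^sup>2)"
    by (rule sum.reindex_bij_betw[OF assms])
  also have "\<dots> = CARD('d) * (norm x)\<^sup>2"
    by (simp add: norm_vec_power2 sum_UNIV_Times sum_distrib_left)
  finally show ?thesis .
qed

lemma sum_norm_in_values:
  fixes R :: "'v::finite \<times> 'd::finite \<Rightarrow> 'v \<times> 'd"
  assumes "bij R"
  shows "(\<Sum>v\<in>UNIV. (norm (in_values R y v))\<^sup>2) = CARD('d) * (norm y)\<^sup>2"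
proof -
  have "in_values R y = out_values (inv R) y"
    by (simp add: fun_eq_iff in_values_def out_values_def)
  then show ?thesis
    by (simp add: sum_norm_out_values assms bij_imp_bij_inv)
qed

context
  fixes G :: "('v::finite, 'e) pre_digraph" and lo li :: "'e \<Rightarrow> 'd::finite"
  assumes G: "verts G = UNIV" "regular_digraph CARD('d) G" "two_way_labeling G lo li"
begin

private abbreviation (input) "R \<equiv> rotation_map G lo li"
private abbreviation (input) "W \<equiv> transition_matrix G"

lemma hdot_transition_matrix_mean_out: "hdot x (W *v y) = hdot (mean_out R x) y"
  unfolding hdot_transition_matrix[OF G] unfolding hdot_def
  by (simp add: mean_out_def vec_mean_def out_values_def sum_UNIV_Times sum_divide_distrib
      sum_distrib_right)

lemma transition_matrix_mult_component: "(W *v y) $ v = vec_mean (in_values R y v)"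
proof -
  have bij: "bij R" by (rule bij_rotation_map[OF G])
  have axis: "cnj (axis v 1 $ u) = of_bool (u = v)" for u
    by (simp add: axis_def)
  have "(W *v y) $ v = hdot (axis v 1) (W *v y)"
    using sum_mult_of_bool_point[of "\<lambda>u. (W *v y) $ u" v]
    by (simp add: hdot_def axis mult.commute)
  \<comment> \<open>Writing \<open>p\<close> as \<open>inv R (R p)\<close> allows reindexing by
    \<open>R p\<close>, that is, by head and in-label.\<close>
  also have "\<dots> = (\<Sum>p\<in>UNIV. cnj (axis v 1 $ fst (R p)) * y $ fst (inv R (R p))) / of_nat CARD('d)"
    using bij by (simp add: hdot_transition_matrix[OF G] bij_is_inj inv_f_f)
  also have "(\<Sum>p\<in>UNIV. cnj (axis v 1 $ fst (R p)) * y $ fst (inv R (R p))) =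
      (\<Sum>p\<in>UNIV. cnj (axis v 1 $ fst p) * y $ fst (inv R p))"
    by (rule sum.reindex_bij_betw[OF bij])
  also have "\<dots> = (\<Sum>u\<in>UNIV. (\<Sum>i\<in>UNIV. y $ fst (inv R (u, i))) * of_bool (u = v))"
    unfolding sum_UNIV_Times fst_conv axis sum_distrib_right by (simp only: mult.commute)
  also have "\<dots> = (\<Sum>i\<in>UNIV. y $ fst (inv R (v, i)))"
    by (rule sum_mult_of_bool_point)
  finally show ?thesis
    by (simp add: vec_mean_def in_values_def)
qed

text \<open>Jensen's inequality at each vertex, followed by the double count.\<close>

lemma norm_mean_out_le: "norm (mean_out R x) \<le> norm x"
proof -
  have "CARD('d) * (norm (mean_out R x))\<^sup>2 \<le> CARD('d) * (norm x)\<^sup>2"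
    unfolding sum_norm_out_values[OF bij_rotation_map[OF G], symmetric]
      norm_vec_power2[of "mean_out R x"] sum_distrib_left
    by (intro sum_mono) (simp add: mean_out_def card_vec_mean_power2_le)
  then show ?thesis by simp
qed

lemma norm_transition_matrix_mult_le: "norm (W *v y) \<le> norm y"
proof -
  have "CARD('d) * (norm (W *v y))\<^sup>2 \<le> CARD('d) * (norm y)\<^sup>2"
    unfolding sum_norm_in_values[OF bij_rotation_map[OF G], symmetric]
      norm_vec_power2[of "W *v y"] sum_distrib_left
    by (intro sum_mono) (simp add: transition_matrix_mult_component card_vec_mean_power2_le)
  then show ?thesis by simp
qed

text \<open>Moving one \<open>W\<close> to the left gives the product of the norms of
  \<open>W\<^sup>* x\<close> and \<open>W x\<close>. Contraction replaces one factor by the norm of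
  \<open>x\<close>, and AM-GM finishes.\<close>

lemma two_cmod_hdot_square_le:
  shows "2 * cmod (hdot x (W *v (W *v x))) \<le> (norm (mean_out R x))\<^sup>2 + (norm x)\<^sup>2" (is ?left)
    and "2 * cmod (hdot x (W *v (W *v x))) \<le> (norm x)\<^sup>2 + (norm (W *v x))\<^sup>2" (is ?right)
proof -
  have le: "cmod (hdot x (W *v (W *v x))) \<le> norm (mean_out R x) * norm (W *v x)"
    unfolding hdot_transition_matrix_mean_out[of x "W *v x"] by (rule cmod_hdot_le)
  also have "\<dots> \<le> norm (mean_out R x) * norm x"
    by (intro mult_left_mono norm_transition_matrix_mult_le norm_ge_zero)
  finally show ?left
    using sum_squares_bound[of "norm (mean_out R x)" "norm x"] by linarith
  note le
  also have "norm (mean_out R x) * norm (W *v x) \<le> norm x * norm (W *v x)"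
    by (intro mult_right_mono norm_mean_out_le norm_ge_zero)
  finally show ?right
    using sum_squares_bound[of "norm x" "norm (W *v x)"] by linarith
qed

text \<open>At the middle vertex \<open>v\<close>, a step in \<open>H\<close> turns the in-label of
  the first arc into the out-label of the second. Averaging over these steps is the matrix of
  \<open>H\<close>; it uses up the factor \<open>CARD('c)\<close> of the degree.\<close>

lemma hdot_derandomized_square:
  fixes H :: "('d, 'f) pre_digraph" and lo' li' :: "'f \<Rightarrow> 'c::finite"
  assumes H: "verts H = UNIV" "regular_digraph CARD('c) H" "two_way_labeling H lo' li'"
  shows "hdot x (transition_matrix (derandomized_square G lo li H lo' li') *v y) =
    (\<Sum>v\<in>UNIV. hdot (out_values R x v) (transition_matrix H *v in_values R y v)) / of_nat CARD('d)"
proof -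
  let ?RH = "rotation_map H lo' li'"
  let ?S = "derandomized_square_map R ?RH"
  have bij: "bij R" by (rule bij_rotation_map[OF G])
  note bS = bij_derandomized_square_map[OF bij bij_rotation_map[OF H]]
  have S: "?S (v, i, j) = (fst (R (fst (R (v, i)), fst (?RH (snd (R (v, i)), j)))),
      snd (R (fst (R (v, i)), fst (?RH (snd (R (v, i)), j)))), snd (?RH (snd (R (v, i)), j)))" for v i j
    by (simp add: derandomized_square_map_def Let_def split: prod.split)
  have rot: "rotation_map (digraph_of_rotation_map UNIV ?S) snd (snd \<circ> ?S) p = ?S p" for p
    by (cases p) (simp only: rotation_map_digraph_of_rotation_map[OF UNIV_I])
  have V: "verts (digraph_of_rotation_map UNIV ?S) = UNIV"
    by (simp add: digraph_of_rotation_map_def)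
  \<comment> \<open>Here \<open>p\<close> names the first arc of a walk by its head, the middle
    vertex, and its in-label; \<open>j\<close> runs over the steps in \<open>H\<close>.\<close>
  define f where "f p = (\<Sum>j\<in>UNIV. cnj (x $ fst (R (fst p, fst (?RH (snd p, j))))) * y $ fst (inv R p))"
    for p
  have "hdot x (transition_matrix (derandomized_square G lo li H lo' li') *v y) =
      (\<Sum>p\<in>UNIV. cnj (x $ fst (?S p)) * y $ fst p) / of_nat (CARD('d \<times> 'c))"
    unfolding derandomized_square_def G(1)
    by (simp only: hdot_transition_matrix[OF V digraph_of_rotation_map_regular[OF bS]] rot)
  also have "(\<Sum>p\<in>UNIV. cnj (x $ fst (?S p)) * y $ fst p) = (\<Sum>v\<in>UNIV. \<Sum>i\<in>UNIV. f (R (v, i)))"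
    using bij by (simp add: sum_UNIV_Times S f_def bij_is_inj inv_f_f)
  also have "\<dots> = (\<Sum>p\<in>UNIV. f (R p))"
    by (simp only: sum_UNIV_Times)
  \<comment> \<open>Renaming first arcs by head instead of tail groups the walks by middle
    vertex.\<close>
  also have "\<dots> = (\<Sum>p\<in>UNIV. f p)"
    by (rule sum.reindex_bij_betw[OF bij])
  also have "\<dots> / of_nat (CARD('d \<times> 'c)) =
      (\<Sum>v\<in>UNIV. hdot (out_values R x v) (transition_matrix H *v in_values R y v)) / of_nat CARD('d)"
    by (simp add: hdot_transition_matrix[OF H] sum_UNIV_Times f_def out_values_def in_values_def
        sum_divide_distrib[symmetric] mult.commute)
  finally show ?thesis .
qed

end

section \<open>Summation of the estimate over the middle vertices\<close>

theorem theorem5p9: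
  fixes G :: "('v::finite, 'e) pre_digraph" and lo li :: "'e \<Rightarrow> 'd::finite"
    and H :: "('d, 'f) pre_digraph" and lo' li' :: "'f \<Rightarrow> 'c::finite"
    and \<epsilon> :: real
  assumes "verts G = UNIV" and "regular_digraph CARD('d) G" and "two_way_labeling G lo li"
    and "verts H = UNIV" and "regular_digraph CARD('c) H" and "undirected H"
    and "two_way_labeling H lo' li'"
    and "spectral_lambda H \<le> \<epsilon>"
  shows "circle_approx (2 * \<epsilon>)
           (transition_matrix (derandomized_square G lo li H lo' li'))
           (transition_matrix G ** transition_matrix G)"
  unfolding circle_approx_def
proof (intro allI)
  fix x y :: "complex ^ 'v"
  note G = assms(1-3) and H = assms(4,5,7)
  let ?W = "transition_matrix G" and ?B = "transition_matrix H" and ?d = "real CARD('d)"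
  let ?W' = "transition_matrix (derandomized_square G lo li H lo' li')"
  let ?A = "mean_out (rotation_map G lo li)"
  define a where "a = out_values (rotation_map G lo li) x"
  define b where "b = in_values (rotation_map G lo li) y"
  have "0 \<le> \<epsilon>"
    using spectral_lambda_nonneg[of H] assms(8) by linarith
  have half: "\<epsilon> / 2 * (2 * t) = 2 * \<epsilon> / 2 * t" for t
    by simp
  have A: "?A x $ v = vec_mean (a v)" for v
    by (simp add: mean_out_def a_def)
  have W: "(?W *v y) $ v = vec_mean (b v)" for v
    by (simp add: transition_matrix_mult_component[OF G] b_def)
  have "hdot x (?W *v (?W *v y)) = (\<Sum>v\<in>UNIV. cnj (vec_mean (a v)) * vec_mean (b v))"
    unfolding hdot_transition_matrix_mean_out[OF G, of x "?W *v y"] hdot_def[of "?A x"] A W ..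
  moreover have "hdot x (?W' *v y) = (\<Sum>v\<in>UNIV. hdot (a v) (?B *v b v)) / ?d"
    by (simp add: hdot_derandomized_square[OF G H] a_def b_def)
  ultimately have "hdot x ((?W ** ?W - ?W') *v y) =
      (\<Sum>v\<in>UNIV. cnj (vec_mean (a v)) * vec_mean (b v)) - (\<Sum>v\<in>UNIV. hdot (a v) (?B *v b v)) / ?d"
    by (simp only: matrix_vector_mult_diff_rdistrib hdot_diff_right matrix_vector_mul_assoc)
  \<comment> \<open>Clearing the denominator leaves at each vertex the difference bounded by
    \<open>transition_matrix_deviation_le\<close>.\<close>
  then have scaled: "?d * hdot x ((?W ** ?W - ?W') *v y) = (\<Sum>v\<in>UNIV.
      of_nat CARD('d) * (cnj (vec_mean (a v)) * vec_mean (b v)) - hdot (a v) (?B *v b v))"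
    by (simp add: sum_subtractf right_diff_distrib flip: sum_distrib_left)
  have "?d * cmod (hdot x ((?W ** ?W - ?W') *v y)) = cmod (\<Sum>v\<in>UNIV.
      of_nat CARD('d) * (cnj (vec_mean (a v)) * vec_mean (b v)) - hdot (a v) (?B *v b v))"
    by (simp add: norm_mult flip: scaled)
  also have "\<dots> \<le> (\<Sum>v\<in>UNIV. \<epsilon> / 2 * ((norm (a v))\<^sup>2 + (norm (b v))\<^sup>2
      - ?d * ((cmod (vec_mean (a v)))\<^sup>2 + (cmod (vec_mean (b v)))\<^sup>2)))"
    by (intro sum_norm_le transition_matrix_deviation_le[OF H assms(8)])
  also have "\<dots> = \<epsilon> / 2 * ((\<Sum>v\<in>UNIV. (norm (a v))\<^sup>2) + (\<Sum>v\<in>UNIV. (norm (b v))\<^sup>2)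
      - ?d * ((norm (?A x))\<^sup>2 + (norm (?W *v y))\<^sup>2))"
    unfolding norm_vec_power2[of "?A x"] norm_vec_power2[of "?W *v y"] A W
    by (simp only: sum_distrib_left[symmetric] sum_subtractf sum.distrib)
  also have "\<dots> = ?d * (\<epsilon> / 2 * ((norm x)\<^sup>2 + (norm y)\<^sup>2 - (norm (?A x))\<^sup>2 - (norm (?W *v y))\<^sup>2))"
    by (simp add: a_def b_def sum_norm_out_values sum_norm_in_values bij_rotation_map[OF G]
        algebra_simps)
  finally have "cmod (hdot x ((?W ** ?W - ?W') *v y)) \<le>
      \<epsilon> / 2 * ((norm x)\<^sup>2 + (norm y)\<^sup>2 - (norm (?A x))\<^sup>2 - (norm (?W *v y))\<^sup>2)"
    by simp
  \<comment> \<open>Trading the norms of \<open>W\<^sup>* x\<close> and \<open>W y\<close> for the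
    forms of the squared matrix costs a factor \<open>2\<close>; this is where \<epsilon> becomes
    \<open>2 * \<epsilon>\<close>.\<close>
  also have "\<dots> \<le> \<epsilon> / 2 * (2 * ((norm x)\<^sup>2 + (norm y)\<^sup>2
      - cmod (hdot x ((?W ** ?W) *v x) + hdot y ((?W ** ?W) *v y))))"
  proof (intro mult_left_mono)
    have "cmod (hdot x ((?W ** ?W) *v x) + hdot y ((?W ** ?W) *v y)) \<le>
        cmod (hdot x (?W *v (?W *v x))) + cmod (hdot y (?W *v (?W *v y)))"
      unfolding matrix_vector_mul_assoc by (rule norm_triangle_ineq)
    then have "2 * cmod (hdot x ((?W ** ?W) *v x) + hdot y ((?W ** ?W) *v y)) \<le>
        2 * cmod (hdot x (?W *v (?W *v x))) + 2 * cmod (hdot y (?W *v (?W *v y)))"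
      by simp
    \<comment> \<open>The first bound serves \<open>x\<close> and the second \<open>y\<close>, so
      that exactly the two norms subtracted above appear.\<close>
    also have "\<dots> \<le> ((norm (?A x))\<^sup>2 + (norm x)\<^sup>2) + ((norm y)\<^sup>2 + (norm (?W *v y))\<^sup>2)"
      by (intro add_mono two_cmod_hdot_square_le[OF G])
    finally show "(norm x)\<^sup>2 + (norm y)\<^sup>2 - (norm (?A x))\<^sup>2 - (norm (?W *v y))\<^sup>2 \<le>
        2 * ((norm x)\<^sup>2 + (norm y)\<^sup>2
          - cmod (hdot x ((?W ** ?W) *v x) + hdot y ((?W ** ?W) *v y)))"
      by simp
  qed (use \<open>0 \<le> \<epsilon>\<close> in simp)
  finally show "cmod (hdot x ((?W ** ?W - ?W') *v y)) \<le> 2 * \<epsilon> / 2 * ((norm x)\<^sup>2 + (norm y)\<^sup>2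
      - cmod (hdot x ((?W ** ?W) *v x) + hdot y ((?W ** ?W) *v y)))"
    unfolding half .
qed

end
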